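(* Let $a\ge2$ be an integer, $\alpha:=\log(a/(a-1))$, $\gamma$ the Euler--Mascheroni constant, and $N_q$ as in the context. Then $$\frac{\gamma+\log a}{\alpha}\le\liminf_{q\to\infty}\Bigl(EN_q-\frac{\log q}{\alpha}\Bigr)\le\limsup_{q\to\infty}\Bigl(EN_q-\frac{\log q}{\alpha}\Bigr)\le\frac{\gamma+\log a}{\alpha}+1.$$
   Context: Coupon collecting: fix an integer $a\ge2$. Let $Y$ be the number of independent uniform draws (with replacement) from a set of $a$ types needed until every one of the $a$ types has been drawn at least once. For $q\in\{1,2,\ldots\}$, $N_q:=\max\{Y_1,\ldots,Y_q\}$, where $Y_1,\ldots,Y_q$ are independent random variables each distributed as $Y$. (Equivalently, a test has $q$ questions, each chosen independently and uniformly from its own separate bank of $a$ alternatives; $N_q$ is the number of independently generated tests needed to see all $aq$ questions at least once.) The integer $a$ is fixed while $q\to\infty$. *)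

theory Defs
  imports "HOL-Probability.Probability"
begin

text \<open>
  Draws are numbered from 1.  The waiting time is \<open>\<infinity>\<close> on the (null) event that some
  type in \<open>T\<close> is never drawn.
\<close>

definition coupon_time :: "'t set \<Rightarrow> (nat \<Rightarrow> 'w \<Rightarrow> 't) \<Rightarrow> 'w \<Rightarrow> enat" where
  "coupon_time T X \<omega> = (INF n\<in>{n. T \<subseteq> (\<lambda>i. X i \<omega>) ` {1..n}}. enat n)"

definition uniform_draws :: "'w measure \<Rightarrow> 't set \<Rightarrow> (nat \<Rightarrow> 'w \<Rightarrow> 't) \<Rightarrow> bool" where
  "uniform_draws P T X \<longleftrightarrow>
     prob_space.indep_vars P (\<lambda>_. count_space T) X {1..} \<and>
     (\<forall>i\<ge>1. distr P (count_space T) (X i) = uniform_count_measure T)"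

text \<open>Only meaningful for \<open>q \<ge> 1\<close>.\<close>

definition max_time :: "(nat \<Rightarrow> 'm \<Rightarrow> enat) \<Rightarrow> nat \<Rightarrow> 'm \<Rightarrow> enat" where
  "max_time Y q \<omega> = Max ((\<lambda>i. Y i \<omega>) ` {1..q})"

text \<open>
  The expectation is taken in the extended nonnegative reals, so that finiteness of the mean
  is part of what an upper bound asserts.
\<close>

definition mean_enat :: "'m measure \<Rightarrow> ('m \<Rightarrow> enat) \<Rightarrow> ereal" where
  "mean_enat M N = enn2ereal (\<integral>\<^sup>+ \<omega>. ennreal_of_enat (N \<omega>) \<partial>M)"

end

theory Submission
  imports Defs
begin

text \<open>
  Let \<open>t\<^sub>n = Pr(Y > n)\<close>, \<open>r = exp (-\<alpha>) = 1 - 1/a\<close> and \<open>g u = 1 - (1 - u)^q\<close>, so that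
  \<open>EN\<^sub>q = (\<Sum>n. g t\<^sub>n)\<close>.  The union bound and a Bonferroni bound over the missing types give
  \<open>t\<^sub>n \<le> a r^n\<close> and \<open>t\<^sub>n \<ge> c r^n\<close> for each \<open>c < a\<close> and all large \<open>n\<close>.  A sum
  \<open>\<Sum>n. g (u r^n)\<close> is compared with the integral of \<open>x \<mapsto> g (u exp (-\<alpha> x))\<close>, which after
  the substitution \<open>v = u exp (-\<alpha> x)\<close> is \<open>1/\<alpha>\<close> times the integral of \<open>g v / v\<close> over
  \<open>[0, u]\<close>.  The latter is a polynomial in \<open>u\<close>, with value the \<open>q\<close>-th harmonic number
  at \<open>u = 1\<close>.
\<close>

section \<open>The integral of \<open>g v / v\<close> in closed form\<close>

text \<open>The integral over \<open>[0, u]\<close> of \<open>(1 - (1 - v) ^ q) / v\<close>: this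
  integrand is the geometric sum of \<open>(1 - v) ^ k\<close> over \<open>k < q\<close>, integrated
  term by term.\<close>

definition harm_poly :: "nat \<Rightarrow> real \<Rightarrow> real" where
  "harm_poly q u = (\<Sum>k<q. (1 - (1 - u) ^ Suc k) / real (Suc k))"

lemma harm_poly_0 [simp]: "harm_poly q 0 = 0"
  by (simp add: harm_poly_def)

lemma harm_poly_1: "harm_poly q 1 = harm q"
  unfolding harm_poly_def harm_def
  by (rule sum.reindex_bij_witness[of _ "\<lambda>k. k - 1" Suc]) (auto simp: divide_inverse)

lemma harm_poly_nonneg: "0 \<le> u \<Longrightarrow> u \<le> 1 \<Longrightarrow> 0 \<le> harm_poly q u"
  unfolding harm_poly_def
  by (intro sum_nonneg divide_nonneg_nonneg) (auto simp del: power_Suc intro: power_le_one)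

lemma harm_poly_deriv:
  "(harm_poly q has_real_derivative (\<Sum>k<q. (1 - u) ^ k)) (at u)"
proof -
  have "((\<lambda>u. (1 - (1 - u) ^ Suc k) / real (Suc k)) has_real_derivative (1 - u) ^ k) (at u)" for k
    by (rule derivative_eq_intros refl | simp)+
  then show ?thesis
    unfolding harm_poly_def[abs_def] by (intro DERIV_sum) 
qed

lemma one_minus_power_sum: "1 - (1 - u) ^ q = u * (\<Sum>k<q. (1 - u) ^ k)" for u :: real
  using one_diff_power_eq[of "1 - u" q] by simp

lemma one_minus_power_mono:
  fixes s t :: real
  assumes "s \<le> t" "t \<le> 1"
  shows "1 - (1 - s) ^ q \<le> 1 - (1 - t) ^ q"
  using assms by (simp add: power_mono)

text \<open>Along \<open>v = u * exp (- x)\<close> the factor \<open>v\<close> from the chain rule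
  cancels the \<open>1 / v\<close> of the integrand, so \<open>harm_poly\<close> falls at rate
  \<open>1 - (1 - v) ^ q\<close>. This rate does not increase with \<open>x\<close>, so over a
  length \<open>d\<close> its mean lies between its values at the two ends.\<close>

lemma harm_poly_exp_diff_bounds:
  assumes "0 \<le> u" "u \<le> 1" "0 \<le> d"
  shows "d * (1 - (1 - u * exp (- d)) ^ q) \<le> harm_poly q u - harm_poly q (u * exp (- d))"
    and "harm_poly q u - harm_poly q (u * exp (- d)) \<le> d * (1 - (1 - u) ^ q)"
proof -
  have *: "d * (1 - (1 - u * exp (- d)) ^ q) \<le> harm_poly q u - harm_poly q (u * exp (- d)) \<and>
        harm_poly q u - harm_poly q (u * exp (- d)) \<le> d * (1 - (1 - u) ^ q)"
  proof (cases "d = 0")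
    case False
    have deriv: "((\<lambda>x. harm_poly q (u * exp (- x))) has_real_derivative
        - (1 - (1 - u * exp (- x)) ^ q)) (at x)" for x
    proof -
      have "((\<lambda>x. u * exp (- x)) has_real_derivative - (u * exp (- x))) (at x)"
        by (auto intro!: derivative_eq_intros)
      from DERIV_chain2[OF harm_poly_deriv this] show ?thesis
        by (simp add: one_minus_power_sum mult_ac)
    qed
    obtain z where z: "0 < z" "z < d" and
      eq: "harm_poly q (u * exp (- d)) - harm_poly q (u * exp (- 0)) =
            (d - 0) * - (1 - (1 - u * exp (- z)) ^ q)"
      using MVT2[of 0 d "\<lambda>x. harm_poly q (u * exp (- x))"
          "\<lambda>x. - (1 - (1 - u * exp (- x)) ^ q)"] deriv False assms by auto
    have "u * exp (- d) \<le> u * exp (- z)" "u * exp (- z) \<le> u"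
      using z assms by (auto intro!: mult_left_mono mult_left_le)
    then have "1 - (1 - u * exp (- d)) ^ q \<le> 1 - (1 - u * exp (- z)) ^ q"
      "1 - (1 - u * exp (- z)) ^ q \<le> 1 - (1 - u) ^ q"
      using assms by (intro one_minus_power_mono; linarith)+
    then show ?thesis
      using eq assms by (auto simp: algebra_simps dest: mult_left_mono[of _ _ d])
  qed simp
  from * show "d * (1 - (1 - u * exp (- d)) ^ q) \<le> harm_poly q u - harm_poly q (u * exp (- d))"
    and "harm_poly q u - harm_poly q (u * exp (- d)) \<le> d * (1 - (1 - u) ^ q)" by blast+
qed

text \<open>As \<open>g v \<le> 1\<close>, the integral of \<open>g v / v\<close> over
  \<open>[u, 1]\<close> is at most \<open>- ln u\<close>. In the preceding bounds, this is the path
  of length \<open>- ln u\<close> that leads from \<open>1\<close> down to \<open>u\<close>.\<close>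

lemma harm_poly_ge:
  assumes "0 < u" "u \<le> 1"
  shows "harm q + ln u \<le> harm_poly q u"
proof -
  have "harm_poly q 1 - harm_poly q (1 * exp (- (- ln u))) \<le> (- ln u) * (1 - (1 - 1) ^ q)"
    using assms by (intro harm_poly_exp_diff_bounds) auto
  also have "\<dots> \<le> - ln u"
    using assms by (auto simp: power_0_left)
  finally show ?thesis
    using assms by (simp add: harm_poly_1)
qed

section \<open>Comparison of sums of \<open>g\<close> with the integral\<close>

text \<open>Integral test: the piece of the integral between consecutive points of the geometric
  sequence lies between \<open>d * f (Suc n)\<close> and \<open>d * f n\<close>, and the pieces
  telescope. The upper estimate keeps the first term exactly instead of bounding it by 1, which the
  sharp upper constant relies on later.\<close>

lemma geometric_one_minus_power:
  fixes u d :: real and q :: nat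
  assumes u: "0 \<le> u" "u \<le> 1" and d: "0 < d"
  defines "f \<equiv> \<lambda>n. 1 - (1 - u * exp (- d) ^ n) ^ q"
  shows "summable f" "harm_poly q u / d \<le> suminf f"
    "suminf f \<le> (1 - (1 - u) ^ q) + harm_poly q u / d"
proof -
  define v where "v n = u * exp (- d) ^ n" for n
  have v01: "0 \<le> v n" "v n \<le> 1" for n
    using u d by (auto simp: v_def intro!: mult_le_one power_le_one)
  have v_Suc: "v n * exp (- d) = v (Suc n)" for n
    by (simp add: v_def)
  have f_v: "f n = 1 - (1 - v n) ^ q" for n
    by (simp add: f_def v_def)
  have f_nonneg: "0 \<le> f n" for n
    using v01[of n] by (auto simp: f_v intro: power_le_one)
  have tele: "(\<Sum>n<N. harm_poly q (v n) - harm_poly q (v (Suc n))) = harm_poly q u - harm_poly q (v N)" for N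
    by (induction N) (auto simp: v_def)
  \<comment> \<open>A bound on partial sums, uniform in \<open>N\<close>, yields both summability
    and the upper estimate.\<close>
  have "d * (\<Sum>n<N. f (Suc n)) \<le> harm_poly q u" for N
  proof -
    have "d * (\<Sum>n<N. f (Suc n)) \<le> (\<Sum>n<N. harm_poly q (v n) - harm_poly q (v (Suc n)))"
      unfolding sum_distrib_left f_v using v01 d
      by (intro sum_mono) (metis harm_poly_exp_diff_bounds(1) v_Suc less_imp_le)
    also have "\<dots> \<le> harm_poly q u"
      using harm_poly_nonneg[OF v01] by (simp add: tele)
    finally show ?thesis .
  qed
  then have up: "(\<Sum>n<N. f (Suc n)) \<le> harm_poly q u / d" for N
    using d by (simp add: field_simps)
  have sumSuc: "summable (\<lambda>n. f (Suc n))"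
  proof (rule bounded_imp_summable)
    show "(\<Sum>n\<le>N. f (Suc n)) \<le> harm_poly q u / d" for N
      using up[of "Suc N"] by (simp only: lessThan_Suc_atMost)
  qed (use f_nonneg in auto)
  then show sum: "summable f"
    by (simp add: summable_Suc_iff)
  have "suminf f = f 0 + (\<Sum>n. f (Suc n))"
    using suminf_split_head[OF sum] by simp
  also have "(\<Sum>n. f (Suc n)) \<le> harm_poly q u / d"
    using up by (intro suminf_le_const sumSuc) 
  finally show "suminf f \<le> (1 - (1 - u) ^ q) + harm_poly q u / d"
    by (simp add: f_def)
  have "harm_poly q u - harm_poly q (v N) \<le> d * suminf f" for N
  proof -
    have "harm_poly q u - harm_poly q (v N) \<le> d * (\<Sum>n<N. f n)"
      unfolding tele[symmetric] sum_distrib_left f_v using v01 d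
      by (intro sum_mono) (metis harm_poly_exp_diff_bounds(2) v_Suc less_imp_le)
    also have "\<dots> \<le> d * suminf f"
      using d f_nonneg by (intro mult_left_mono sum_le_suminf sum) auto
    finally show ?thesis .
  qed
  \<comment> \<open>The part of the integral below \<open>v N\<close> vanishes in the limit, by
    continuity at 0.\<close>
  moreover have "(\<lambda>N. harm_poly q u - harm_poly q (v N)) \<longlonglongrightarrow> harm_poly q u - harm_poly q 0"
  proof -
    have "v \<longlonglongrightarrow> u * 0"
      unfolding v_def using d by (intro tendsto_intros LIMSEQ_power_zero) auto
    then show ?thesis
      by (intro tendsto_intros isCont_tendsto_compose[OF DERIV_isCont[OF harm_poly_deriv]]) auto
  qed
  ultimately have "harm_poly q u - harm_poly q 0 \<le> d * suminf f"
    by (intro LIMSEQ_le_const2) auto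
  then show "harm_poly q u / d \<le> suminf f"
    using d by (simp add: field_simps)
qed

text \<open>The geometric bound may exceed 1 at first, so the first \<open>m\<close> terms are
  bounded by 1 and only the tail is compared with the integral. Rounding \<open>ln a / d\<close> up
  to \<open>m\<close> costs \<open>e\<close>, the first tail term costs \<open>g u\<close>, and the
  integral over \<open>[u, 1]\<close> gives back at least \<open>e * g u\<close>. The total excess
  \<open>e + (1 - e) * g u\<close> is at most 1.\<close>

lemma suminf_one_minus_power_le:
  fixes t :: "nat \<Rightarrow> real" and a d :: real
  assumes t01: "\<And>n. 0 \<le> t n" "\<And>n. t n \<le> 1" and t_le: "\<And>n. t n \<le> a * exp (- d) ^ n"
    and a: "1 \<le> a" and d: "0 < d"
  shows "summable (\<lambda>n. 1 - (1 - t n) ^ q)"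
    and "(\<Sum>n. 1 - (1 - t n) ^ q) \<le> 1 + (ln a + harm q) / d"
proof -
  \<comment> \<open>The least index at which \<open>a * exp (- d) ^ m \<le> 1\<close>.\<close>
  define m where "m = nat \<lceil>ln a / d\<rceil>"
  define e where "e = real m - ln a / d"
  define u where "u = a * exp (- d) ^ m"
  define f where "f = (\<lambda>n. 1 - (1 - t n) ^ q)"
  have e: "0 \<le> e" "e \<le> 1"
    using a d unfolding e_def m_def by (simp, linarith?)+
  have "u = exp (ln a - d * real m)"
    using a by (simp add: u_def exp_diff exp_minus exp_of_nat_mult[symmetric] mult_ac divide_inverse power_inverse)
  also have "ln a - d * real m = - (d * e)"
    using d by (simp add: e_def field_simps)
  finally have u: "u = 1 * exp (- (d * e))"
    by simp
  have u01: "0 \<le> u" "u \<le> 1"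
    using e d by (simp_all add: u)
  have f_nonneg: "0 \<le> f n" for n
    using t01[of n] by (auto simp: f_def intro: power_le_one)
  have f_le_1: "f n \<le> 1" for n
    using t01[of n] by (auto simp: f_def)
  let ?g = "\<lambda>n. 1 - (1 - u * exp (- d) ^ n) ^ q"
  have f_le: "f (n + m) \<le> ?g n" for n
  proof -
    have "u * exp (- d) ^ n \<le> 1"
      using u01 d by (intro mult_le_one power_le_one) auto
    then show ?thesis
      using t_le[of "n + m"] unfolding f_def
      by (intro one_minus_power_mono) (auto simp: u_def power_add mult_ac)
  qed
  note g = geometric_one_minus_power[OF u01 d, of q]
  have "summable (\<lambda>n. f (n + m))"
    using f_le f_nonneg by (intro summable_comparison_test'[OF g(1), of 0]) auto
  then have sum: "summable f"
    by (simp add: summable_iff_shift)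
  then show "summable (\<lambda>n. 1 - (1 - t n) ^ q)"
    by (simp add: f_def)
  have "suminf f = (\<Sum>n. f (n + m)) + (\<Sum>n<m. f n)"
    by (rule suminf_split_initial_segment[OF sum])
  also have "(\<Sum>n<m. f n) \<le> real m"
    using sum_mono[of "{..<m}" f "\<lambda>_. 1"] f_le_1 by simp
  also have "(\<Sum>n. f (n + m)) \<le> suminf ?g"
    by (intro suminf_le f_le g \<open>summable (\<lambda>n. f (n + m))\<close>)
  also have "suminf ?g \<le> (1 - (1 - u) ^ q) + harm_poly q u / d"
    by (rule g)
  \<comment> \<open>The path from \<open>1\<close> to \<open>u\<close> has length
    \<open>d * e\<close>; its end value \<open>g u\<close> bounds the rate from below.\<close>
  also have "harm_poly q u / d \<le> harm q / d - e * (1 - (1 - u) ^ q)"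
  proof -
    have "d * e * (1 - (1 - u) ^ q) \<le> harm_poly q 1 - harm_poly q u"
      unfolding u using e d by (intro harm_poly_exp_diff_bounds) auto
    then show ?thesis
      using d by (simp add: field_simps harm_poly_1)
  qed
  also have "(1 - (1 - u) ^ q) + (harm q / d - e * (1 - (1 - u) ^ q)) + real m =
      1 + (ln a + harm q) / d - (1 - e) * (1 - u) ^ q"
    by (simp add: e_def algebra_simps add_divide_distrib)
  also have "\<dots> \<le> 1 + (ln a + harm q) / d"
    using e u01 by simp
  finally show "(\<Sum>n. 1 - (1 - t n) ^ q) \<le> 1 + (ln a + harm q) / d"
    by (simp add: f_def)
qed

text \<open>Starting the geometric comparison at \<open>m\<close> costs \<open>real m\<close>
  through \<open>ln u\<close>. The first \<open>m\<close> terms, each at least \<open>g u\<close> by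
  monotonicity, restore this up to \<open>real m * (1 - u) ^ q\<close>, an error that vanishes as
  \<open>q\<close> grows with \<open>m\<close> fixed and \<open>u > 0\<close>.\<close>

lemma suminf_one_minus_power_ge:
  fixes t :: "nat \<Rightarrow> real" and c d :: real
  assumes t: "\<And>n. t n \<le> 1" "decseq t"
    and t_ge: "\<And>n. n \<ge> m \<Longrightarrow> c * exp (- d) ^ n \<le> t n"
    and c: "0 < c" and d: "0 < d"
    and sum: "summable (\<lambda>n. 1 - (1 - t n) ^ q)"
  shows "(ln c + harm q) / d - real m * (1 - c * exp (- d) ^ m) ^ q \<le> (\<Sum>n. 1 - (1 - t n) ^ q)"
proof -
  define u where "u = c * exp (- d) ^ m"
  define f where "f = (\<lambda>n. 1 - (1 - t n) ^ q)"
  \<comment> \<open>Below \<open>m\<close> the geometric lower bound is not assumed; there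
    \<open>t n \<ge> t m \<ge> u\<close>.\<close>
  have u_t: "u \<le> t n" if "n \<le> m" for n
    using t_ge[of m] decseqD[OF t(2) that] by (simp add: u_def)
  have u01: "0 < u" "u \<le> 1"
    using c u_t[of m] t(1)[of m] by (auto simp: u_def)
  let ?g = "\<lambda>n. 1 - (1 - u * exp (- d) ^ n) ^ q"
  note g = geometric_one_minus_power[OF less_imp_le[OF u01(1)] u01(2) d, of q]
  have "ln u = ln c - d * real m"
    using c by (simp add: u_def ln_mult ln_realpow)
  then have "(ln c + harm q) / d - real m * (1 - u) ^ q
      = (harm q + ln u) / d + real m * (1 - (1 - u) ^ q)"
    using d by (simp add: field_simps)
  also have "\<dots> \<le> harm_poly q u / d + real m * (1 - (1 - u) ^ q)"
    using harm_poly_ge[OF u01, of q] d by (simp add: divide_right_mono)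
  also have "harm_poly q u / d \<le> suminf ?g"
    by (rule g)
  also have "suminf ?g \<le> (\<Sum>n. f (n + m))"
  proof (intro suminf_le g)
    show "?g n \<le> f (n + m)" for n
      using t_ge[of "n + m"] t(1)[of "n + m"] unfolding f_def
      by (intro one_minus_power_mono) (auto simp: u_def power_add mult_ac)
    show "summable (\<lambda>n. f (n + m))"
      unfolding f_def by (rule summable_ignore_initial_segment[OF sum])
  qed
  also have "real m * (1 - (1 - u) ^ q) \<le> (\<Sum>n<m. f n)"
  proof -
    have "(\<Sum>n<m. 1 - (1 - u) ^ q) \<le> (\<Sum>n<m. f n)"
      unfolding f_def using u_t t(1) by (intro sum_mono one_minus_power_mono) auto
    then show ?thesis
      by simp
  qed
  also have "(\<Sum>n. f (n + m)) + (\<Sum>n<m. f n) = suminf f"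
    using suminf_split_initial_segment[of f m] sum by (simp add: f_def)
  finally show ?thesis
    by (simp add: f_def u_def)
qed

section \<open>Independence and measurability of extended natural times\<close>

text \<open>The empty \<open>J\<close> is included so that the case of no draws,
  \<open>n = 0\<close>, is covered uniformly below.\<close>

lemma (in prob_space) prob_indep_vars_INT:
  assumes indep: "indep_vars N Y I" and J: "J \<subseteq> I" "finite J"
    and A: "\<And>i. i \<in> J \<Longrightarrow> A i \<in> sets (N i)"
  shows "prob {\<omega> \<in> space M. \<forall>i\<in>J. Y i \<omega> \<in> A i} = (\<Prod>i\<in>J. prob (Y i -` A i \<inter> space M))"
proof (cases "J = {}")
  case True
  then show ?thesis
    by (simp add: prob_space)
next
  case False
  have "{\<omega> \<in> space M. \<forall>i\<in>J. Y i \<omega> \<in> A i} = (\<Inter>i\<in>J. Y i -` A i \<inter> space M)"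
    using False by auto
  then show ?thesis
    using indep_varsD[OF indep False J(2,1) A] by simp
qed

text \<open>As \<open>enat\<close> is countable, preimages of singletons suffice: a finite value is
  cut out by two level sets, and \<open>\<infinity>\<close> is what remains outside all of
  them.\<close>

lemma measurable_count_space_enat:
  fixes Y :: "'a \<Rightarrow> enat"
  assumes "\<And>n. {\<omega> \<in> space M. Y \<omega> \<le> enat n} \<in> sets M"
  shows "Y \<in> measurable M (count_space UNIV)"
proof (rule measurable_count_space_eq2_countable[THEN iffD2], intro conjI ballI)
  have gt: "{\<omega> \<in> space M. Y \<omega> \<ge> enat n} \<in> sets M" for n
  proof (cases n)
    case (Suc k)
    have "{\<omega> \<in> space M. Y \<omega> \<ge> enat n} = space M - {\<omega> \<in> space M. Y \<omega> \<le> enat k}"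
      by (auto simp: Suc not_le Suc_ile_eq)
    then show ?thesis
      using assms by auto
  qed (simp add: zero_enat_def[symmetric])
  fix y :: enat
  show "Y -` {y} \<inter> space M \<in> sets M"
  proof (cases y)
    case (enat n)
    have "Y -` {y} \<inter> space M = {\<omega> \<in> space M. Y \<omega> \<le> enat n} \<inter> {\<omega> \<in> space M. Y \<omega> \<ge> enat n}"
      by (auto simp: enat)
    then show ?thesis
      using assms gt by auto
  next
    case infinity
    have "Y \<omega> = \<infinity> \<longleftrightarrow> (\<forall>n. \<not> Y \<omega> \<le> enat n)" for \<omega>
      by (cases "Y \<omega>") auto
    then have "Y -` {y} \<inter> space M = space M - (\<Union>n. {\<omega> \<in> space M. Y \<omega> \<le> enat n})"
      by (auto simp: infinity)
    then show ?thesis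
      using assms by auto
  qed
qed auto

text \<open>The infimum of a nonempty set of \<open>enat\<close> is attained, and a covering initial
  segment stays covering when extended; over the empty set the infimum is
  \<open>\<infinity>\<close>.\<close>

lemma coupon_time_le_iff: "coupon_time T X \<omega> \<le> enat n \<longleftrightarrow> T \<subseteq> (\<lambda>i. X i \<omega>) ` {1..n}"
proof
  assume le: "coupon_time T X \<omega> \<le> enat n"
  let ?S = "{n. T \<subseteq> (\<lambda>i. X i \<omega>) ` {1..n}}"
  have "?S \<noteq> {}"
  proof
    assume "?S = {}"
    then have "coupon_time T X \<omega> = top"
      unfolding coupon_time_def by (simp only: image_empty Inf_empty)
    then show False
      using le by (simp add: top_enat_def)
  qed
  then obtain m where "m \<in> ?S"
    by blast
  then have "coupon_time T X \<omega> \<in> enat ` ?S"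
    unfolding coupon_time_def by (intro wellorder_InfI[of "enat m"] imageI)
  then obtain k where "T \<subseteq> (\<lambda>i. X i \<omega>) ` {1..k}" "coupon_time T X \<omega> = enat k"
    by auto
  then show "T \<subseteq> (\<lambda>i. X i \<omega>) ` {1..n}"
    using le image_mono[of "{1..k}" "{1..n}" "\<lambda>i. X i \<omega>"] by auto
qed (auto simp: coupon_time_def intro: INF_lower)

section \<open>Tail bounds for a single collector\<close>

locale coupon_collector = prob_space P
  for P :: "'w measure" and T :: "'t set" and X :: "nat \<Rightarrow> 'w \<Rightarrow> 't" +
  assumes card_T: "card T \<ge> 2" and draws: "uniform_draws P T X"
begin

lemma finite_T: "finite T"
  using card_T card.infinite by fastforce

lemma draw_measurable: "i \<ge> 1 \<Longrightarrow> X i \<in> measurable P (count_space T)"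
  using draws by (auto simp: uniform_draws_def indep_vars_def2)

lemma prob_draw:
  assumes "i \<ge> 1" "B \<subseteq> T"
  shows "prob (X i -` B \<inter> space P) = real (card B) / real (card T)"
proof -
  have "prob (X i -` B \<inter> space P) = measure (distr P (count_space T) (X i)) B"
    using assms draw_measurable by (subst measure_distr) auto
  also have "\<dots> = real (card B) / real (card T)"
    using assms draws finite_T by (simp add: uniform_draws_def measure_uniform_count_measure)
  finally show ?thesis .
qed

text \<open>Membership in \<open>T - {j}\<close> is the form to which independence applies; on
  \<open>space P\<close> it amounts to \<open>X i \<omega> \<noteq> j\<close>, as draws with
  \<open>i \<ge> 1\<close> lie in \<open>T\<close>.\<close>

definition missed :: "nat \<Rightarrow> 't \<Rightarrow> 'w set" where
  "missed n j = {\<omega> \<in> space P. \<forall>i\<in>{1..n}. X i \<omega> \<in> T - {j}}"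

text \<open>A general \<open>B\<close> serves both one missing type (union bound) and two
  (Bonferroni bound).\<close>

lemma prob_avoid:
  assumes "B \<subseteq> T"
  shows "prob {\<omega> \<in> space P. \<forall>i\<in>{1..n}. X i \<omega> \<in> T - B} = (1 - real (card B) / real (card T)) ^ n"
proof -
  have "prob {\<omega> \<in> space P. \<forall>i\<in>{1..n}. X i \<omega> \<in> T - B} = (\<Prod>i\<in>{1..n}. prob (X i -` (T - B) \<inter> space P))"
    using draws by (intro prob_indep_vars_INT[where I = "{1..}"]) (auto simp: uniform_draws_def)
  also have "\<dots> = (\<Prod>i\<in>{1..n}. real (card (T - B)) / real (card T))"
    by (intro prod.cong prob_draw) auto
  also have "real (card (T - B)) / real (card T) = 1 - real (card B) / real (card T)"
    using card_T card_gt_0_iff[of T] assms finite_T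
    by (simp add: card_Diff_subset finite_subset card_mono of_nat_diff diff_divide_distrib)
  finally show ?thesis
    by simp
qed

lemma missed_events: "missed n j \<in> events"
proof -
  have "{\<omega> \<in> space P. X i \<omega> \<in> T - {j}} \<in> events" if "i \<in> {1..n}" for i
    using measurable_sets[OF draw_measurable[of i], of "T - {j}"] that
    by (simp add: vimage_def Int_def conj_commute)
  then show ?thesis
    unfolding missed_def by (intro sets.sets_Collect_finite_All) auto
qed

lemma prob_missed: "j \<in> T \<Longrightarrow> prob (missed n j) = (1 - 1 / real (card T)) ^ n"
  using prob_avoid[of "{j}" n] by (simp add: missed_def)

lemma prob_missed_two:
  assumes "j \<in> T" "k \<in> T" "j \<noteq> k"
  shows "prob (missed n j \<inter> missed n k) = (1 - 2 / real (card T)) ^ n"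
proof -
  have "missed n j \<inter> missed n k = {\<omega> \<in> space P. \<forall>i\<in>{1..n}. X i \<omega> \<in> T - {j, k}}"
    by (auto simp: missed_def)
  then show ?thesis
    using prob_avoid[of "{j, k}" n] assms by simp
qed

lemma coupon_time_gt_eq:
  "{\<omega> \<in> space P. coupon_time T X \<omega> > enat n} = (\<Union>j\<in>T. missed n j)"
proof -
  have "X i \<omega> \<in> T" if "\<omega> \<in> space P" "i \<ge> 1" for i \<omega>
    using measurable_space[OF draw_measurable, of i \<omega>] that by simp
  then show ?thesis
    unfolding not_le[symmetric] coupon_time_le_iff by (fastforce simp: missed_def)
qed

lemma coupon_time_measurable: "coupon_time T X \<in> measurable P (count_space UNIV)"
proof (rule measurable_count_space_enat)
  fix n
  have "{\<omega> \<in> space P. coupon_time T X \<omega> \<le> enat n} = space P - (\<Union>j\<in>T. missed n j)"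
    unfolding coupon_time_gt_eq[symmetric] by auto
  then show "{\<omega> \<in> space P. coupon_time T X \<omega> \<le> enat n} \<in> events"
    using missed_events finite_T by (simp add: sets.compl_sets sets.finite_UN)
qed

lemma prob_coupon_time_gt_le:
  "prob {\<omega> \<in> space P. coupon_time T X \<omega> > enat n} \<le> real (card T) * (1 - 1 / real (card T)) ^ n"
proof -
  have "prob (\<Union>j\<in>T. missed n j) \<le> (\<Sum>j\<in>T. prob (missed n j))"
    using missed_events finite_T by (intro finite_measure_subadditive_finite) auto
  then show ?thesis
    by (simp add: coupon_time_gt_eq prob_missed)
qed

text \<open>The events that exactly one given type is missing are disjoint; this gives a
  Bonferroni-type bound.\<close>

lemma prob_coupon_time_gt_ge:
  "real (card T) * ((1 - 1 / real (card T)) ^ n - real (card T) * (1 - 2 / real (card T)) ^ n)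
     \<le> prob {\<omega> \<in> space P. coupon_time T X \<omega> > enat n}"
proof -
  define E where "E j = missed n j - (\<Union>k\<in>T - {j}. missed n k)" for j
  have E: "E j \<in> events" for j
    using missed_events finite_T by (auto simp: E_def)
  \<comment> \<open>Here \<open>card T \<ge> 2\<close> enters; the sign allows
    \<open>card (T - {j})\<close> to be enlarged to \<open>card T\<close> below.\<close>
  have s: "0 \<le> (1 - 2 / real (card T)) ^ n"
    using card_T by (intro zero_le_power) simp
  have "(1 - 1 / real (card T)) ^ n - real (card T) * (1 - 2 / real (card T)) ^ n \<le> prob (E j)"
    if j: "j \<in> T" for j
  proof -
    have "prob (\<Union>k\<in>T - {j}. missed n j \<inter> missed n k) \<le> (\<Sum>k\<in>T - {j}. prob (missed n j \<inter> missed n k))"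
      using missed_events finite_T by (intro finite_measure_subadditive_finite) auto
    also have "\<dots> = (\<Sum>k\<in>T - {j}. (1 - 2 / real (card T)) ^ n)"
      using j by (intro sum.cong prob_missed_two) auto
    also have "\<dots> = real (card (T - {j})) * (1 - 2 / real (card T)) ^ n"
      by simp
    also have "\<dots> \<le> real (card T) * (1 - 2 / real (card T)) ^ n"
      using s finite_T by (intro mult_right_mono) (auto intro: card_mono)
    finally have "prob (missed n j) - real (card T) * (1 - 2 / real (card T)) ^ n
        \<le> prob (missed n j) - prob (\<Union>k\<in>T - {j}. missed n j \<inter> missed n k)"
      by simp
    also have "\<dots> = prob (missed n j - (\<Union>k\<in>T - {j}. missed n j \<inter> missed n k))"
      using missed_events finite_T by (intro finite_measure_Diff[symmetric]) auto
    also have "missed n j - (\<Union>k\<in>T - {j}. missed n j \<inter> missed n k) = E j"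
      by (auto simp: E_def)
    finally show ?thesis
      using prob_missed[OF j] by simp
  qed
  then have "(\<Sum>j\<in>T. (1 - 1 / real (card T)) ^ n - real (card T) * (1 - 2 / real (card T)) ^ n)
      \<le> (\<Sum>j\<in>T. prob (E j))"
    by (intro sum_mono)
  also have "\<dots> = prob (\<Union>j\<in>T. E j)"
    using E finite_T
    by (intro finite_measure_finite_Union[symmetric]) (auto simp: disjoint_family_on_def E_def)
  also have "\<dots> \<le> prob (\<Union>j\<in>T. missed n j)"
    using missed_events finite_T by (intro finite_measure_mono) (auto simp: E_def)
  finally show ?thesis
    by (simp add: coupon_time_gt_eq)
qed

end

section \<open>The maximum of \<open>q\<close> independent times\<close>

text \<open>The complement is the event that all \<open>q\<close> times are at most
  \<open>n\<close>, which factors by independence. The maximum is over a nonempty set because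
  \<open>q \<ge> 1\<close>.\<close>

lemma (in prob_space) prob_max_time_gt:
  assumes indep: "indep_vars (\<lambda>_. count_space UNIV) Y {1..}"
    and t: "\<And>i. i \<ge> 1 \<Longrightarrow> prob {\<omega> \<in> space M. Y i \<omega> > enat n} = t"
    and q: "q \<ge> 1"
  shows "prob {\<omega> \<in> space M. max_time Y q \<omega> > enat n} = 1 - (1 - t) ^ q"
proof -
  have Y: "Y i \<in> measurable M (count_space UNIV)" if "i \<ge> 1" for i
    using indep that by (auto simp: indep_vars_def2)
  have Yle: "prob (Y i -` {..enat n} \<inter> space M) = 1 - t" if "i \<ge> 1" for i
  proof -
    have "Y i -` {..enat n} \<inter> space M = space M - {\<omega> \<in> space M. Y i \<omega> > enat n}"
      by auto
    moreover have "{\<omega> \<in> space M. Y i \<omega> > enat n} \<in> events"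
      using measurable_sets[OF Y[OF that], of "{enat n<..}"] 
      by (simp add: vimage_def Int_def conj_commute)
    ultimately show ?thesis
      using t[OF that] by (simp add: prob_compl)
  qed
  have eq: "{\<omega> \<in> space M. max_time Y q \<omega> > enat n} =
      space M - {\<omega> \<in> space M. \<forall>i\<in>{1..q}. Y i \<omega> \<in> {..enat n}}"
    using q by (auto simp: max_time_def Max_gr_iff not_le)
  have ev: "{\<omega> \<in> space M. \<forall>i\<in>{1..q}. Y i \<omega> \<in> {..enat n}} \<in> events"
  proof (intro sets.sets_Collect_finite_All)
    show "{\<omega> \<in> space M. Y i \<omega> \<in> {..enat n}} \<in> events" if "i \<in> {1..q}" for i
      using measurable_sets[OF Y, of i "{..enat n}"] that
      by (simp add: vimage_def Int_def conj_commute)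
  qed auto
  have "prob {\<omega> \<in> space M. \<forall>i\<in>{1..q}. Y i \<omega> \<in> {..enat n}} = (\<Prod>i\<in>{1..q}. prob (Y i -` {..enat n} \<inter> space M))"
    by (intro prob_indep_vars_INT[OF indep]) auto
  also have "\<dots> = (1 - t) ^ q"
    using Yle by simp
  finally show ?thesis
    using ev by (simp add: eq prob_compl)
qed

text \<open>The tail-sum formula for the mean; summability makes the extended sum a finite real
  number.\<close>

lemma (in prob_space) mean_enat_max_time:
  assumes indep: "indep_vars (\<lambda>_. count_space UNIV) Y {1..}"
    and t: "\<And>i n. i \<ge> 1 \<Longrightarrow> prob {\<omega> \<in> space M. Y i \<omega> > enat n} = t n"
    and q: "q \<ge> 1" and sum: "summable (\<lambda>n. 1 - (1 - t n) ^ q)"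
  shows "mean_enat M (max_time Y q) = ereal (\<Sum>n. 1 - (1 - t n) ^ q)"
proof -
  have Y: "Y i \<in> measurable M (count_space UNIV)" if "i \<ge> 1" for i
    using indep that by (auto simp: indep_vars_def2)
  have max_meas: "max_time Y q \<in> measurable M (count_space UNIV)"
  proof (rule measurable_count_space_enat)
    fix n
    have "{\<omega> \<in> space M. max_time Y q \<omega> \<le> enat n} = {\<omega> \<in> space M. \<forall>i\<in>{1..q}. Y i \<omega> \<le> enat n}"
      using q by (auto simp: max_time_def)
    also have "\<dots> \<in> events"
    proof (intro sets.sets_Collect_finite_All)
      show "{\<omega> \<in> space M. Y i \<omega> \<le> enat n} \<in> events" if "i \<in> {1..q}" for i
        using measurable_sets[OF Y, of i "{..enat n}"] that
        by (simp add: vimage_def Int_def conj_commute)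
    qed auto
    finally show "{\<omega> \<in> space M. max_time Y q \<omega> \<le> enat n} \<in> events" .
  qed
  have nonneg: "0 \<le> 1 - (1 - t n) ^ q" for n
    using prob_max_time_gt[OF indep t q, of n] measure_nonneg by metis
  have "(\<integral>\<^sup>+ \<omega>. ennreal_of_enat (max_time Y q \<omega>) \<partial>M)
      = (\<Sum>n. emeasure M {\<omega> \<in> space M. enat n < max_time Y q \<omega>})"
    by (rule nn_integral_enat_function[OF max_meas])
  also have "\<dots> = (\<Sum>n. ennreal (1 - (1 - t n) ^ q))"
    by (simp add: emeasure_eq_measure prob_max_time_gt[OF indep t q])
  also have "\<dots> = ennreal (\<Sum>n. 1 - (1 - t n) ^ q)"
    by (rule suminf_ennreal2[OF nonneg sum])
  finally show ?thesis
    by (simp add: mean_enat_def suminf_nonneg[OF sum nonneg])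
qed

section \<open>Passage to the limit, first in \<open>n\<close> and then in \<open>q\<close>\<close>

lemma exp_neg_ln_ratio:
  fixes a :: real
  assumes "a > 1"
  shows "exp (- ln (a / (a - 1))) = 1 - 1 / a"
  using assms by (simp add: exp_minus field_simps)

text \<open>Divided by \<open>r ^ n\<close>, the Bonferroni bound becomes
  \<open>A - A * A * (s / r) ^ n\<close>, which tends to \<open>A > c\<close> because
  \<open>s < r\<close>.\<close>

lemma (in coupon_collector) prob_coupon_time_gt_asymp:
  assumes "c < real (card T)"
  shows "\<forall>\<^sub>F n in sequentially.
    c * (1 - 1 / real (card T)) ^ n \<le> prob {\<omega> \<in> space P. coupon_time T X \<omega> > enat n}"
proof -
  define A where "A = real (card T)"
  define r where "r = 1 - 1 / A"
  define s where "s = 1 - 2 / A"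
  have A: "A \<ge> 2"
    using card_T by (simp add: A_def)
  then have r: "r > 0" and s: "0 \<le> s" "s < r"
    by (simp_all add: r_def s_def field_simps)
  have "(\<lambda>n. A - A * A * (s / r) ^ n) \<longlonglongrightarrow> A - A * A * 0"
    using r s by (intro tendsto_intros LIMSEQ_power_zero) simp
  then have "\<forall>\<^sub>F n in sequentially. c < A - A * A * (s / r) ^ n"
    using assms by (auto simp: A_def dest: order_tendstoD(1))
  then show ?thesis
  proof eventually_elim
    case (elim n)
    then have "c * r ^ n \<le> (A - A * A * (s / r) ^ n) * r ^ n"
      using r by (intro mult_right_mono) auto
    also have "\<dots> = A * (r ^ n - A * s ^ n)"
      using r by (simp add: field_simps)
    also have "\<dots> \<le> prob {\<omega> \<in> space P. coupon_time T X \<omega> > enat n}"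
      using prob_coupon_time_gt_ge[of n] by (simp add: A_def r_def s_def)
    finally show ?case
      by (simp add: A_def r_def)
  qed
qed

theorem theorem4p3:
  fixes a :: nat and \<alpha> :: real
    and P :: "'w measure" and T :: "'t set" and X :: "nat \<Rightarrow> 'w \<Rightarrow> 't"
    and M :: "'m measure" and Y :: "nat \<Rightarrow> 'm \<Rightarrow> enat"
  assumes "a \<ge> 2" and "card T = a"
    and "\<alpha> = ln (real a / (real a - 1))"
    and "prob_space P" and "uniform_draws P T X"
    and "prob_space M"
    and "prob_space.indep_vars M (\<lambda>_. count_space UNIV) Y {1..}"
    and "\<And>i. i \<ge> 1 \<Longrightarrow>
           distr M (count_space UNIV) (Y i) = distr P (count_space UNIV) (coupon_time T X)"
  shows "ereal ((euler_mascheroni + ln (real a)) / \<alpha>)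
           \<le> liminf (\<lambda>q. mean_enat M (max_time Y q) - ereal (ln (real q) / \<alpha>))
       \<and> liminf (\<lambda>q. mean_enat M (max_time Y q) - ereal (ln (real q) / \<alpha>))
           \<le> limsup (\<lambda>q. mean_enat M (max_time Y q) - ereal (ln (real q) / \<alpha>))
       \<and> limsup (\<lambda>q. mean_enat M (max_time Y q) - ereal (ln (real q) / \<alpha>))
           \<le> ereal ((euler_mascheroni + ln (real a)) / \<alpha> + 1)"
proof -
  interpret P: coupon_collector P T X
    using assms by (simp add: coupon_collector_def coupon_collector_axioms_def)
  interpret M: prob_space M
    by fact
  define t where "t n = P.prob {\<omega> \<in> space P. coupon_time T X \<omega> > enat n}" for n
  have \<alpha>: "\<alpha> > 0" and r: "exp (- \<alpha>) = 1 - 1 / real a"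
    using assms(1) by (simp_all add: assms(3) exp_neg_ln_ratio)
  have t01: "0 \<le> t n" "t n \<le> 1" for n
    by (simp_all add: t_def)
  have t_le: "t n \<le> real a * exp (- \<alpha>) ^ n" for n
    using P.prob_coupon_time_gt_le[of n] by (simp add: t_def r assms(2))
  have "{\<omega> \<in> space P. coupon_time T X \<omega> > enat n} \<in> P.events" for n
    unfolding P.coupon_time_gt_eq using P.missed_events P.finite_T by (simp add: sets.finite_UN)
  then have "decseq t"
    unfolding t_def by (intro decseq_SucI P.finite_measure_mono) (auto intro: less_trans[rotated])
  \<comment> \<open>The times \<open>Y i\<close> live on \<open>M\<close> and the draws on
    \<open>P\<close>; equality of laws carries the tail over.\<close>
  have Y: "M.prob {\<omega> \<in> space M. Y i \<omega> > enat n} = t n" if "i \<ge> 1" for i n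
  proof -
    have "Y i \<in> measurable M (count_space UNIV)"
      using assms(7) that by (auto simp: M.indep_vars_def2)
    then have "M.prob {\<omega> \<in> space M. Y i \<omega> > enat n}
        = measure (distr M (count_space UNIV) (Y i)) {enat n<..}"
      by (subst measure_distr) (auto intro!: arg_cong[where f = M.prob])
    also have "\<dots> = t n"
      unfolding assms(8)[OF that] t_def using P.coupon_time_measurable
      by (subst measure_distr) (auto intro!: arg_cong[where f = P.prob])
    finally show ?thesis .
  qed
  define S where "S q = (\<Sum>n. 1 - (1 - t n) ^ q)" for q
  note up = suminf_one_minus_power_le[OF t01 t_le _ \<alpha>]
  have a1: "1 \<le> real a"
    using assms(1) by simp
  have mean: "mean_enat M (max_time Y q) = ereal (S q)" if "q \<ge> 1" for q
    unfolding S_def by (rule M.mean_enat_max_time[OF assms(7) Y that up(1)[OF a1]])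
  \<comment> \<open>The threshold \<open>m\<close> depends on \<open>c\<close>, so \<open>c\<close>
    stays fixed while \<open>q\<close> grows and the error \<open>real m * w ^ q\<close> dies
    out.\<close>
  have liminf: "ereal ((euler_mascheroni + ln c) / \<alpha>)
      \<le> liminf (\<lambda>q. mean_enat M (max_time Y q) - ereal (ln (real q) / \<alpha>))"
    if c: "0 < c" "c < real a" for c
  proof -
    obtain m where m: "c * exp (- \<alpha>) ^ n \<le> t n" if "n \<ge> m" for n
      using P.prob_coupon_time_gt_asymp[of c] c
      by (auto simp: t_def r assms(2) eventually_sequentially)
    define w where "w = 1 - c * exp (- \<alpha>) ^ m"
    have w: "0 \<le> w" "w < 1"
      using m[of m] t01(2)[of m] c by (simp_all add: w_def)
    have "(\<lambda>q. ln c / \<alpha> + (harm q - ln (real q)) / \<alpha> - real m * w ^ q)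
        \<longlonglongrightarrow> ln c / \<alpha> + euler_mascheroni / \<alpha> - real m * 0"
      using w \<alpha> by (intro tendsto_intros euler_mascheroni_LIMSEQ LIMSEQ_power_zero) auto
    then have lim: "liminf (\<lambda>q. ereal (ln c / \<alpha> + (harm q - ln (real q)) / \<alpha> - real m * w ^ q))
        = ereal ((euler_mascheroni + ln c) / \<alpha>)"
      by (intro lim_imp_Liminf) (auto simp: add_divide_distrib add.commute)
    have "\<forall>\<^sub>F q in sequentially. ereal (ln c / \<alpha> + (harm q - ln (real q)) / \<alpha> - real m * w ^ q)
        \<le> mean_enat M (max_time Y q) - ereal (ln (real q) / \<alpha>)"
      using eventually_ge_at_top[of 1]
    proof eventually_elim
      case (elim q)
      have "(ln c + harm q) / \<alpha> - real m * w ^ q \<le> S q"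
        unfolding S_def w_def
        by (rule suminf_one_minus_power_ge[OF t01(2) \<open>decseq t\<close> m c(1) \<alpha> up(1)[OF a1]])
      then show ?case
        by (simp add: mean[OF elim] add_divide_distrib diff_divide_distrib)
    qed
    from Liminf_mono[OF this] show ?thesis
      unfolding lim .
  qed
  \<comment> \<open>The liminf does not involve \<open>c\<close>, so \<open>c\<close> may now
    increase to \<open>a\<close>, by continuity of \<open>ln\<close>.\<close>
  have "((\<lambda>c. ereal ((euler_mascheroni + ln c) / \<alpha>)) \<longlongrightarrow> ereal ((euler_mascheroni + ln (real a)) / \<alpha>))
      (at_left (real a))"
    using a1 \<alpha> by (intro tendsto_intros) auto
  moreover have "\<forall>\<^sub>F c in at_left (real a). c \<in> {0<..<real a}"
    using a1 by (intro eventually_at_left_real) simp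
  then have "\<forall>\<^sub>F c in at_left (real a). ereal ((euler_mascheroni + ln c) / \<alpha>)
      \<le> liminf (\<lambda>q. mean_enat M (max_time Y q) - ereal (ln (real q) / \<alpha>))"
    by eventually_elim (use liminf in auto)
  ultimately have lower: "ereal ((euler_mascheroni + ln (real a)) / \<alpha>)
      \<le> liminf (\<lambda>q. mean_enat M (max_time Y q) - ereal (ln (real q) / \<alpha>))"
    by (rule tendsto_upperbound) simp
  \<comment> \<open>The upper bound holds for every \<open>q \<ge> 1\<close> with the constant
    \<open>a\<close> itself, so a single limit suffices.\<close>
  have "(\<lambda>q. 1 + ln (real a) / \<alpha> + (harm q - ln (real q)) / \<alpha>)
      \<longlonglongrightarrow> 1 + ln (real a) / \<alpha> + euler_mascheroni / \<alpha>"
    using \<alpha> by (intro tendsto_intros euler_mascheroni_LIMSEQ) auto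
  then have lim: "limsup (\<lambda>q. ereal (1 + ln (real a) / \<alpha> + (harm q - ln (real q)) / \<alpha>))
      = ereal ((euler_mascheroni + ln (real a)) / \<alpha> + 1)"
    by (intro lim_imp_Limsup) (auto simp: add_divide_distrib add_ac)
  have "\<forall>\<^sub>F q in sequentially. mean_enat M (max_time Y q) - ereal (ln (real q) / \<alpha>)
      \<le> ereal (1 + ln (real a) / \<alpha> + (harm q - ln (real q)) / \<alpha>)"
    using eventually_ge_at_top[of 1]
  proof eventually_elim
    case (elim q)
    have "S q \<le> 1 + (ln (real a) + harm q) / \<alpha>"
      unfolding S_def by (rule up(2)[OF a1])
    then show ?case
      by (simp add: mean[OF elim] add_divide_distrib diff_divide_distrib)
  qed
  from Limsup_mono[OF this] have upper: "limsup (\<lambda>q. mean_enat M (max_time Y q) - ereal (ln (real q) / \<alpha>))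
      \<le> ereal ((euler_mascheroni + ln (real a)) / \<alpha> + 1)"
    unfolding lim .
  show ?thesis
    using lower upper by (intro conjI Liminf_le_Limsup) simp_all
qed

end
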